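(* Let $\mathcal{C}$ be complete and $B\colon\mathcal{C}\to\mathcal{C}$ an endofunctor such that the codensity monad $(\mathrm{Ran}_{\bar B}\bar B,\eta,\mu)$ of its final sequence $\bar B$ (with counit $\epsilon$) exists and $B$ preserves the right Kan extension $\mathrm{Ran}_{\bar B}\bar B$. Let $\tau\colon(\mathrm{Ran}_{\bar B}\bar B)B\Rightarrow B(\mathrm{Ran}_{\bar B}\bar B)$ be the unique natural transformation with $B\epsilon_i\circ\tau_{B_i}=\epsilon_{i+1}$ for all ordinals $i$. Then $\tau$ is a distributive law of the monad $(\mathrm{Ran}_{\bar B}\bar B,\eta,\mu)$ over $B$, i.e. $B\eta=\tau\circ\eta B$ and $\tau\circ\mu B=B\mu\circ\tau(\mathrm{Ran}_{\bar B}\bar B)\circ(\mathrm{Ran}_{\bar B}\bar B)\tau$.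
   Context: Final sequence $\bar B\colon\mathrm{Ord}^{op}\to\mathcal{C}$: $B_0=1$, $B_{i+1}=BB_i$, $B_j=\lim_{i<j}B_i$ at limit $j$, connecting maps $B_{j,i}$ with $B_{i,i}=\mathrm{id}$, $B_{j+1,i+1}=BB_{j,i}$. Note $B_{i+1}=BB_i$, so $\epsilon_{i+1}$ has type $(\mathrm{Ran}_{\bar B}\bar B)BB_i\to BB_i$. Codensity monad of $\bar B$: the right Kan extension $(T,\epsilon)=(\mathrm{Ran}_{\bar B}\bar B,\epsilon)$ of $\bar B$ along itself, i.e. $\epsilon\colon T\bar B\Rightarrow\bar B$ such that every $\alpha\colon H\bar B\Rightarrow\bar B$ factors as $\epsilon\circ\hat\alpha\bar B$ for a unique $\hat\alpha\colon H\Rightarrow T$; its unit $\eta$ and multiplication $\mu$ are the unique natural transformations with $\epsilon\circ\eta\bar B=\mathrm{id}_{\bar B}$ and $\epsilon\circ\mu\bar B=\epsilon\circ T\epsilon$. $B$ preserves it if $(BT,B\epsilon)$ is a right Kan extension of $B\bar B$ along $\bar B$ (this guarantees existence and uniqueness of $\tau$). *)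

theory Defs
  imports Main
begin

section \<open>Categories, functors, natural transformations\<close>

record ('x, 'm) cat =
  Obj :: "'x set"
  Arr :: "'m set"
  Dom :: "'m \<Rightarrow> 'x"
  Cod :: "'m \<Rightarrow> 'x"
  Ident :: "'x \<Rightarrow> 'm"
  Comp :: "'m \<Rightarrow> 'm \<Rightarrow> 'm"  (infixl "\<cdot>\<index>" 70)

definition hom :: "('x, 'm) cat \<Rightarrow> 'x \<Rightarrow> 'x \<Rightarrow> 'm set" where
  "hom C x y = {f \<in> Arr C. Dom C f = x \<and> Cod C f = y}"

locale category =
  fixes C :: "('x, 'm) cat" (structure)
  assumes Dom_Obj: "f \<in> Arr C \<Longrightarrow> Dom C f \<in> Obj C"
    and Cod_Obj: "f \<in> Arr C \<Longrightarrow> Cod C f \<in> Obj C"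
    and Ident_hom: "x \<in> Obj C \<Longrightarrow> Ident C x \<in> hom C x x"
    and Comp_hom: "f \<in> hom C x y \<Longrightarrow> g \<in> hom C y z \<Longrightarrow> g \<cdot> f \<in> hom C x z"
    and Ident_left: "f \<in> hom C x y \<Longrightarrow> Ident C y \<cdot> f = f"
    and Ident_right: "f \<in> hom C x y \<Longrightarrow> f \<cdot> Ident C x = f"
    and Comp_assoc: "f \<in> hom C x y \<Longrightarrow> g \<in> hom C y z \<Longrightarrow> h \<in> hom C z w \<Longrightarrow>
      (h \<cdot> g) \<cdot> f = h \<cdot> (g \<cdot> f)"

definition op_cat :: "('x, 'm) cat \<Rightarrow> ('x, 'm) cat" where
  "op_cat C = \<lparr>Obj = Obj C, Arr = Arr C, Dom = Cod C, Cod = Dom C, Ident = Ident C,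
     Comp = (\<lambda>g f. f \<cdot>\<^bsub>C\<^esub> g)\<rparr>"

definition full_sub :: "('x, 'm) cat \<Rightarrow> 'x set \<Rightarrow> ('x, 'm) cat" where
  "full_sub C S = C\<lparr>Obj := S, Arr := {f \<in> Arr C. Dom C f \<in> S \<and> Cod C f \<in> S}\<rparr>"

record ('x, 'm, 'y, 'n) fctr =
  ob :: "'x \<Rightarrow> 'y"
  ar :: "'m \<Rightarrow> 'n"

definition is_functor ::
  "('x, 'm) cat \<Rightarrow> ('y, 'n) cat \<Rightarrow> ('x, 'm, 'y, 'n) fctr \<Rightarrow> bool" where
  "is_functor C D F \<longleftrightarrow> category C \<and> category D \<and>
     (\<forall>x\<in>Obj C. ob F x \<in> Obj D) \<and>
     (\<forall>x y. \<forall>f\<in>hom C x y. ar F f \<in> hom D (ob F x) (ob F y)) \<and>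
     (\<forall>x\<in>Obj C. ar F (Ident C x) = Ident D (ob F x)) \<and>
     (\<forall>x y z. \<forall>f\<in>hom C x y. \<forall>g\<in>hom C y z. ar F (g \<cdot>\<^bsub>C\<^esub> f) = ar F g \<cdot>\<^bsub>D\<^esub> ar F f)"

definition id_fctr :: "('x, 'm, 'x, 'm) fctr" where
  "id_fctr = \<lparr>ob = (\<lambda>x. x), ar = (\<lambda>f. f)\<rparr>"

definition const_fctr :: "('y, 'n) cat \<Rightarrow> 'y \<Rightarrow> ('x, 'm, 'y, 'n) fctr" where
  "const_fctr D y = \<lparr>ob = (\<lambda>_. y), ar = (\<lambda>_. Ident D y)\<rparr>"

definition comp_fctr ::
  "('y, 'n, 'z, 'k) fctr \<Rightarrow> ('x, 'm, 'y, 'n) fctr \<Rightarrow> ('x, 'm, 'z, 'k) fctr"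
  (infixl "\<odot>" 75) where
  "G \<odot> F = \<lparr>ob = (\<lambda>x. ob G (ob F x)), ar = (\<lambda>f. ar G (ar F f))\<rparr>"

lemma comp_fctr_sel [simp]: "ob (G \<odot> F) x = ob G (ob F x)" "ar (G \<odot> F) f = ar G (ar F f)"
  by (simp_all add: comp_fctr_def)

lemma is_functor_comp: "is_functor C D F \<Longrightarrow> is_functor D E G \<Longrightarrow> is_functor C E (G \<odot> F)"
  unfolding is_functor_def comp_fctr_def by (auto; metis)

text \<open>A transformation is its family of components; only the components at objects of the domain
  category are meaningful, so equality of transformations is always stated on \<^term>\<open>Obj C\<close>.\<close>

definition nat_trans ::
  "('x, 'm) cat \<Rightarrow> ('y, 'n) cat \<Rightarrow> ('x, 'm, 'y, 'n) fctr \<Rightarrow> ('x, 'm, 'y, 'n) fctr \<Rightarrow>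
   ('x \<Rightarrow> 'n) \<Rightarrow> bool" where
  "nat_trans C D F G \<alpha> \<longleftrightarrow> is_functor C D F \<and> is_functor C D G \<and>
     (\<forall>x\<in>Obj C. \<alpha> x \<in> hom D (ob F x) (ob G x)) \<and>
     (\<forall>x y. \<forall>f\<in>hom C x y. \<alpha> y \<cdot>\<^bsub>D\<^esub> ar F f = ar G f \<cdot>\<^bsub>D\<^esub> \<alpha> x)"

definition is_terminal :: "('x, 'm) cat \<Rightarrow> 'x \<Rightarrow> bool" where
  "is_terminal C t \<longleftrightarrow> t \<in> Obj C \<and> (\<forall>x\<in>Obj C. \<exists>!f. f \<in> hom C x t)"

definition is_limit ::
  "('j, 'i) cat \<Rightarrow> ('x, 'm) cat \<Rightarrow> ('j, 'i, 'x, 'm) fctr \<Rightarrow> 'x \<Rightarrow> ('j \<Rightarrow> 'm) \<Rightarrow> bool" where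
  "is_limit J C D L \<pi> \<longleftrightarrow> L \<in> Obj C \<and> nat_trans J C (const_fctr C L) D \<pi> \<and>
     (\<forall>X\<in>Obj C. \<forall>\<xi>. nat_trans J C (const_fctr C X) D \<xi> \<longrightarrow>
        (\<exists>!u. u \<in> hom C X L \<and> (\<forall>j\<in>Obj J. \<pi> j \<cdot>\<^bsub>C\<^esub> u = \<xi> j)))"

section \<open>Right Kan extensions, codensity monads, distributive laws\<close>

text \<open>\<open>(R, \<epsilon>)\<close> is a right Kan extension of \<open>F : J \<rightarrow> E\<close> along \<open>K : J \<rightarrow> D\<close>.\<close>

definition is_ran ::
  "('j, 'i) cat \<Rightarrow> ('x, 'm) cat \<Rightarrow> ('y, 'n) cat \<Rightarrow> ('j, 'i, 'x, 'm) fctr \<Rightarrow>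
   ('j, 'i, 'y, 'n) fctr \<Rightarrow> ('x, 'm, 'y, 'n) fctr \<Rightarrow> ('j \<Rightarrow> 'n) \<Rightarrow> bool" where
  "is_ran J D E K F R \<epsilon> \<longleftrightarrow>
     is_functor J D K \<and> is_functor J E F \<and> is_functor D E R \<and>
     nat_trans J E (R \<odot> K) F \<epsilon> \<and>
     (\<forall>H \<alpha>. is_functor D E H \<and> nat_trans J E (H \<odot> K) F \<alpha> \<longrightarrow>
        (\<exists>\<beta>. nat_trans D E H R \<beta> \<and> (\<forall>j\<in>Obj J. \<epsilon> j \<cdot>\<^bsub>E\<^esub> \<beta> (ob K j) = \<alpha> j) \<and>
           (\<forall>\<gamma>. nat_trans D E H R \<gamma> \<and> (\<forall>j\<in>Obj J. \<epsilon> j \<cdot>\<^bsub>E\<^esub> \<gamma> (ob K j) = \<alpha> j) \<longrightarrow>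
              (\<forall>x\<in>Obj D. \<gamma> x = \<beta> x))))"

definition preserves_ran ::
  "('j, 'i) cat \<Rightarrow> ('x, 'm) cat \<Rightarrow> ('y, 'n) cat \<Rightarrow> ('z, 'k) cat \<Rightarrow> ('y, 'n, 'z, 'k) fctr \<Rightarrow>
   ('j, 'i, 'x, 'm) fctr \<Rightarrow> ('j, 'i, 'y, 'n) fctr \<Rightarrow> ('x, 'm, 'y, 'n) fctr \<Rightarrow> ('j \<Rightarrow> 'n) \<Rightarrow> bool"
  where
  "preserves_ran J D E E' G K F R \<epsilon> \<longleftrightarrow>
     is_functor E E' G \<and> is_ran J D E' K (G \<odot> F) (G \<odot> R) (\<lambda>j. ar G (\<epsilon> j))"

definition is_monad ::
  "('x, 'm) cat \<Rightarrow> ('x, 'm, 'x, 'm) fctr \<Rightarrow> ('x \<Rightarrow> 'm) \<Rightarrow> ('x \<Rightarrow> 'm) \<Rightarrow> bool" where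
  "is_monad C T \<eta> \<mu> \<longleftrightarrow>
     is_functor C C T \<and> nat_trans C C id_fctr T \<eta> \<and> nat_trans C C (T \<odot> T) T \<mu> \<and>
     (\<forall>x\<in>Obj C. \<mu> x \<cdot>\<^bsub>C\<^esub> \<eta> (ob T x) = Ident C (ob T x) \<and>
                 \<mu> x \<cdot>\<^bsub>C\<^esub> ar T (\<eta> x) = Ident C (ob T x) \<and>
                 \<mu> x \<cdot>\<^bsub>C\<^esub> \<mu> (ob T x) = \<mu> x \<cdot>\<^bsub>C\<^esub> ar T (\<mu> x))"

definition codensity_monad ::
  "('j, 'i) cat \<Rightarrow> ('x, 'm) cat \<Rightarrow> ('j, 'i, 'x, 'm) fctr \<Rightarrow> ('x, 'm, 'x, 'm) fctr \<Rightarrow>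
   ('j \<Rightarrow> 'm) \<Rightarrow> ('x \<Rightarrow> 'm) \<Rightarrow> ('x \<Rightarrow> 'm) \<Rightarrow> bool" where
  "codensity_monad J C K T \<epsilon> \<eta> \<mu> \<longleftrightarrow>
     is_ran J C C K K T \<epsilon> \<and>
     nat_trans C C id_fctr T \<eta> \<and> (\<forall>j\<in>Obj J. \<epsilon> j \<cdot>\<^bsub>C\<^esub> \<eta> (ob K j) = Ident C (ob K j)) \<and>
     nat_trans C C (T \<odot> T) T \<mu> \<and> (\<forall>j\<in>Obj J. \<epsilon> j \<cdot>\<^bsub>C\<^esub> \<mu> (ob K j) = \<epsilon> j \<cdot>\<^bsub>C\<^esub> ar T (\<epsilon> j))"

definition distributive_law ::
  "('x, 'm) cat \<Rightarrow> ('x, 'm, 'x, 'm) fctr \<Rightarrow> ('x \<Rightarrow> 'm) \<Rightarrow> ('x \<Rightarrow> 'm) \<Rightarrow>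
   ('x, 'm, 'x, 'm) fctr \<Rightarrow> ('x \<Rightarrow> 'm) \<Rightarrow> bool" where
  "distributive_law C T \<eta> \<mu> B \<tau> \<longleftrightarrow>
     is_monad C T \<eta> \<mu> \<and> is_functor C C B \<and> nat_trans C C (T \<odot> B) (B \<odot> T) \<tau> \<and>
     (\<forall>x\<in>Obj C. ar B (\<eta> x) = \<tau> x \<cdot>\<^bsub>C\<^esub> \<eta> (ob B x)) \<and>
     (\<forall>x\<in>Obj C. \<tau> x \<cdot>\<^bsub>C\<^esub> \<mu> (ob B x) = ar B (\<mu> x) \<cdot>\<^bsub>C\<^esub> (\<tau> (ob T x) \<cdot>\<^bsub>C\<^esub> ar T (\<tau> x)))"

section \<open>The ordinals of a universe, smallness and completeness\<close>

text \<open>HOL has no type of all ordinals. The class below describes the well-ordered class of all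
  ordinals of a set-theoretic universe: it is closed under replacement (a family of ordinals
  indexed by an ordinal is bounded) and under power sets. Its instances are thus, up to order
  isomorphism, exactly the strongly inaccessible cardinals and \<open>\<omega>\<close>; the axiom of infinity is not
  imposed, so that \<open>nat\<close> (hereditarily finite sets) is an instance.\<close>

class ordinals = wellorder +
  assumes replacement: "\<exists>j. \<forall>k<i. (f :: 'a \<Rightarrow> 'a) k < j"
    and power_set: "\<exists>(j::'a) g. inj_on g (Pow {..<i}) \<and> g ` Pow {..<i} \<subseteq> {..<j}"

instance nat :: ordinals
proof
  fix i :: nat and f :: "nat \<Rightarrow> nat"
  have "\<forall>k<i. f k < Suc (Max (f ` {..<i}))"
    by (auto simp: less_Suc_eq_le)
  then show "\<exists>j. \<forall>k<i. f k < j" ..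
next
  fix i :: nat
  obtain g where g: "bij_betw g (Pow {..<i}) {0..<card (Pow {..<i})}"
    using ex_bij_betw_finite_nat[of "Pow {..<i}"] finite_Pow_iff[of "{..<i}"] finite_lessThan[of i]
    by blast
  show "\<exists>(j::nat) g. inj_on g (Pow {..<i}) \<and> g ` Pow {..<i} \<subseteq> {..<j}"
  proof (intro exI conjI)
    show "inj_on g (Pow {..<i})"
      using g by (rule bij_betw_imp_inj_on)
    show "g ` Pow {..<i} \<subseteq> {..<card (Pow {..<i})}"
      unfolding bij_betw_imp_surj_on[OF g] atLeast0LessThan by (rule subset_refl)
  qed
qed

definition ord_zero :: "'o::ordinals" where
  "ord_zero = (LEAST k. True)"

definition ord_suc :: "'o::ordinals \<Rightarrow> 'o" where
  "ord_suc i = (LEAST k. i < k)"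

definition is_limit_ord :: "'o::ordinals \<Rightarrow> bool" where
  "is_limit_ord j \<longleftrightarrow> j \<noteq> ord_zero \<and> (\<forall>i. j \<noteq> ord_suc i)"

lemma ord_zero_le: "ord_zero \<le> (i::'o::ordinals)"
  unfolding ord_zero_def by (rule Least_le) simp

lemma ord_suc_greater: "(i::'o::ordinals) < ord_suc i"
proof -
  from power_set[of i] obtain j :: 'o and g
    where g: "inj_on g (Pow {..<i})" "g ` Pow {..<i} \<subseteq> {..<j}"
    by (elim exE conjE) (rule that)
  have "i < j"
  proof (rule ccontr)
    assume "\<not> i < j"
    then have sub: "g ` Pow {..<i} \<subseteq> {..<i}"
      using g(2) by (meson lessThan_subset_iff not_less order_trans)
    define S where "S = {k \<in> {..<i}. \<exists>A \<in> Pow {..<i}. k = g A \<and> k \<notin> A}"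
    have S: "S \<in> Pow {..<i}" by (auto simp: S_def)
    have "g S \<in> {..<i}" by (rule subsetD[OF sub imageI[OF S]])
    have "g S \<notin> S"
    proof
      assume "g S \<in> S"
      then obtain A where "A \<in> Pow {..<i}" "g S = g A" "g S \<notin> A"
        unfolding S_def by blast
      with g(1) S have "S = A" by (simp add: inj_on_eq_iff)
      with \<open>g S \<in> S\<close> \<open>g S \<notin> A\<close> show False by simp
    qed
    moreover from this have "g S \<in> S"
      using \<open>g S \<in> {..<i}\<close> S unfolding S_def by blast
    ultimately show False ..
  qed
  then show ?thesis unfolding ord_suc_def by (rule LeastI)
qed

lemma ord_suc_le_iff: "ord_suc i \<le> j \<longleftrightarrow> (i::'o::ordinals) < j"
proof
  show "ord_suc i \<le> j \<Longrightarrow> i < j"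
    using ord_suc_greater less_le_trans by blast
  show "i < j \<Longrightarrow> ord_suc i \<le> j"
    unfolding ord_suc_def by (rule Least_le)
qed

definition ord_cat :: "('o::ordinals, 'o \<times> 'o) cat" where
  "ord_cat = \<lparr>Obj = UNIV, Arr = {(i, j). i \<le> j}, Dom = fst, Cod = snd, Ident = (\<lambda>i. (i, i)),
     Comp = (\<lambda>g f. (fst f, snd g))\<rparr>"

definition small :: "'o::ordinals itself \<Rightarrow> 'a set \<Rightarrow> bool" where
  "small _ A \<longleftrightarrow> (\<exists>(j::'o) f. inj_on f A \<and> f ` A \<subseteq> {..<j})"

text \<open>Every small category is isomorphic to one whose objects and arrows are ordinals, so it
  suffices to quantify over index categories of type \<^typ>\<open>('o::ordinals, 'o) cat\<close>.\<close>

definition complete_cat :: "'o::ordinals itself \<Rightarrow> ('x, 'm) cat \<Rightarrow> bool" where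
  "complete_cat U C \<longleftrightarrow> category C \<and>
     (\<forall>(J :: ('o, 'o) cat) D. small U (Obj J) \<and> small U (Arr J) \<and> is_functor J C D \<longrightarrow>
        (\<exists>L \<pi>. is_limit J C D L \<pi>))"

section \<open>Final sequences\<close>

text \<open>For \<open>i \<le> j\<close> the connecting map \<open>B\<^bsub>j,i\<^esub> : B\<^sub>j \<rightarrow> B\<^sub>i\<close> is the image of \<open>(i, j)\<close>, regarded
  as an arrow \<open>j \<rightarrow> i\<close> of the opposite category. The terminal object and the limits are only
  determined up to isomorphism; any choice is admitted.\<close>

definition final_sequence ::
  "('x, 'm) cat \<Rightarrow> ('x, 'm, 'x, 'm) fctr \<Rightarrow> ('o::ordinals, 'o \<times> 'o, 'x, 'm) fctr \<Rightarrow> bool" where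
  "final_sequence C B S \<longleftrightarrow>
     is_functor C C B \<and> is_functor (op_cat ord_cat) C S \<and>
     is_terminal C (ob S ord_zero) \<and>
     (\<forall>i. ob S (ord_suc i) = ob B (ob S i)) \<and>
     (\<forall>i j. i \<le> j \<longrightarrow> ar S (ord_suc i, ord_suc j) = ar B (ar S (i, j))) \<and>
     (\<forall>j. is_limit_ord j \<longrightarrow>
        is_limit (full_sub (op_cat ord_cat) {..<j}) C S (ob S j) (\<lambda>i. ar S (i, j)))"

lemma Obj_op_ord [simp]: "Obj (op_cat ord_cat) = UNIV"
  by (simp add: op_cat_def ord_cat_def)

lemma hom_op_ord: "hom (op_cat ord_cat) j i = (if i \<le> j then {(i,j)} else {})"
  by (auto simp: op_cat_def ord_cat_def hom_def)

lemma ex_unique_transf: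
  fixes S :: "('o::ordinals, 'o \<times> 'o, 'x, 'm) fctr"
  assumes S: "final_sequence C B S"
    and T: "is_ran (op_cat ord_cat) C C S S T \<epsilon>"
    and P: "preserves_ran (op_cat ord_cat) C C C B S S T \<epsilon>"
  shows "\<exists>\<tau>. nat_trans C C (T \<odot> B) (B \<odot> T) \<tau> \<and>
     (\<forall>i. ar B (\<epsilon> i) \<cdot>\<^bsub>C\<^esub> \<tau> (ob S i) = \<epsilon> (ord_suc i)) \<and>
     (\<forall>\<tau>'. nat_trans C C (T \<odot> B) (B \<odot> T) \<tau>' \<and>
        (\<forall>i. ar B (\<epsilon> i) \<cdot>\<^bsub>C\<^esub> \<tau>' (ob S i) = \<epsilon> (ord_suc i)) \<longrightarrow> (\<forall>x\<in>Obj C. \<tau>' x = \<tau> x))"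
proof -
  let ?J = "op_cat ord_cat :: ('o, 'o \<times> 'o) cat"
  have fB: "is_functor C C B" and fS: "is_functor ?J C S"
    and obS: "\<And>i. ob S (ord_suc i) = ob B (ob S i)"
    and arS: "\<And>i j. i \<le> j \<Longrightarrow> ar S (ord_suc i, ord_suc j) = ar B (ar S (i, j))"
    using S unfolding final_sequence_def by auto
  have fT: "is_functor C C T" and e: "nat_trans ?J C (T \<odot> S) S \<epsilon>"
    using T unfolding is_ran_def by auto
  have mono: "ord_suc i \<le> ord_suc j" if "i \<le> j" for i j :: 'o
    using that ord_suc_greater[of j] by (simp add: ord_suc_le_iff)
  have "nat_trans ?J C ((T \<odot> B) \<odot> S) (B \<odot> S) (\<lambda>i. \<epsilon> (ord_suc i))"
    unfolding nat_trans_def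
  proof (intro conjI ballI allI)
    show "is_functor ?J C ((T \<odot> B) \<odot> S)" "is_functor ?J C (B \<odot> S)"
      by (intro is_functor_comp[OF fS] is_functor_comp[OF fB] fT fB)+
  next
    fix i :: 'o
    have "\<epsilon> (ord_suc i) \<in> hom C (ob (T \<odot> S) (ord_suc i)) (ob S (ord_suc i))"
      using e unfolding nat_trans_def by simp
    then show "\<epsilon> (ord_suc i) \<in> hom C (ob ((T \<odot> B) \<odot> S) i) (ob (B \<odot> S) i)"
      by (simp add: obS)
  next
    fix j i :: 'o and f assume "f \<in> hom ?J j i"
    then have le: "i \<le> j" and f: "f = (i, j)" by (auto simp: hom_op_ord split: if_splits)
    have "(ord_suc i, ord_suc j) \<in> hom ?J (ord_suc j) (ord_suc i)"
      using mono[OF le] by (simp add: hom_op_ord)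
    then have "\<epsilon> (ord_suc i) \<cdot>\<^bsub>C\<^esub> ar (T \<odot> S) (ord_suc i, ord_suc j) =
        ar S (ord_suc i, ord_suc j) \<cdot>\<^bsub>C\<^esub> \<epsilon> (ord_suc j)"
      using e unfolding nat_trans_def by blast
    then show "\<epsilon> (ord_suc i) \<cdot>\<^bsub>C\<^esub> ar ((T \<odot> B) \<odot> S) f = ar (B \<odot> S) f \<cdot>\<^bsub>C\<^esub> \<epsilon> (ord_suc j)"
      using le f by (simp add: arS)
  qed
  moreover have "is_functor C C (T \<odot> B)" by (rule is_functor_comp[OF fB fT])
  moreover have R: "is_ran ?J C C S (B \<odot> S) (B \<odot> T) (\<lambda>j. ar B (\<epsilon> j))"
    using P unfolding preserves_ran_def by auto
  ultimately show ?thesis unfolding is_ran_def by simp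
qed

end

theory Submission imports Defs
begin

text \<open>Two transformations into a right Kan extension agree as soon as they agree after composing
  with its counit. Both the monad laws of the codensity monad and the two axioms of a distributive
  law are equations between transformations into such an extension, \<open>T\<close> respectively \<open>B T\<close>; after
  composing with \<open>\<epsilon>\<close> respectively \<open>B \<epsilon>\<close> they reduce, by naturality and the defining equations of
  \<open>\<eta>\<close>, \<open>\<mu>\<close> and \<open>\<tau>\<close>, to identities about \<open>\<epsilon>\<close> alone.\<close>

section \<open>Elementary rules for functors and components of transformations\<close>

lemma id_fctr_sel [simp]: "ob id_fctr x = x" "ar id_fctr f = f"
  by (simp_all add: id_fctr_def)

text \<open>Both sides unfold to the same record, so this is a genuine equation rather than an
  isomorphism. Sources and targets of whiskered transformations can therefore be rebracketed by
  rewriting.\<close>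

lemma comp_fctr_assoc: "(H \<odot> G) \<odot> F = H \<odot> (G \<odot> F)"
  by (simp add: comp_fctr_def)

lemma comp_id_fctr [simp]: "F \<odot> id_fctr = F" "id_fctr \<odot> F = F"
  by (simp_all add: comp_fctr_def)

lemma is_functor_ob: "is_functor C D F \<Longrightarrow> x \<in> Obj C \<Longrightarrow> ob F x \<in> Obj D"
  by (simp add: is_functor_def)

lemma is_functor_ar: "is_functor C D F \<Longrightarrow> f \<in> hom C x y \<Longrightarrow> ar F f \<in> hom D (ob F x) (ob F y)"
  by (simp add: is_functor_def)

lemma is_functor_Ident:
  "is_functor C D F \<Longrightarrow> x \<in> Obj C \<Longrightarrow> ar F (Ident C x) = Ident D (ob F x)"
  by (simp add: is_functor_def)

lemma is_functor_Comp:
  "is_functor C D F \<Longrightarrow> f \<in> hom C x y \<Longrightarrow> g \<in> hom C y z \<Longrightarrow>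
    ar F (g \<cdot>\<^bsub>C\<^esub> f) = ar F g \<cdot>\<^bsub>D\<^esub> ar F f"
  unfolding is_functor_def by blast

lemma nat_trans_hom: "nat_trans C D F G \<alpha> \<Longrightarrow> x \<in> Obj C \<Longrightarrow> \<alpha> x \<in> hom D (ob F x) (ob G x)"
  by (simp add: nat_trans_def)

lemma nat_trans_natural:
  "nat_trans C D F G \<alpha> \<Longrightarrow> f \<in> hom C x y \<Longrightarrow> \<alpha> y \<cdot>\<^bsub>D\<^esub> ar F f = ar G f \<cdot>\<^bsub>D\<^esub> \<alpha> x"
  unfolding nat_trans_def by blast

lemma (in category) hom_Obj: "f \<in> hom C x y \<Longrightarrow> x \<in> Obj C \<and> y \<in> Obj C"
  using Dom_Obj Cod_Obj by (auto simp: hom_def)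

section \<open>Identities, vertical composition and whiskering of transformations\<close>

text \<open>Presents the identity side of the unit laws as a transformation, so that uniqueness of
  factorizations applies to it.\<close>

lemma nat_trans_Ident:
  assumes F: "is_functor C D F"
  shows "nat_trans C D F F (\<lambda>x. Ident D (ob F x))"
proof -
  interpret D: category D using F by (simp add: is_functor_def)
  show ?thesis
    unfolding nat_trans_def
  proof (intro conjI ballI allI F)
    show "Ident D (ob F x) \<in> hom D (ob F x) (ob F x)" if "x \<in> Obj C" for x
      by (rule D.Ident_hom[OF is_functor_ob[OF F that]])
    show "Ident D (ob F y) \<cdot>\<^bsub>D\<^esub> ar F f = ar F f \<cdot>\<^bsub>D\<^esub> Ident D (ob F x)"
      if "f \<in> hom C x y" for x y f
      using is_functor_ar[OF F that] by (simp only: D.Ident_left D.Ident_right)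
  qed
qed

lemma nat_trans_vcomp:
  assumes a: "nat_trans C D F G \<alpha>" and b: "nat_trans C D G H \<beta>"
  shows "nat_trans C D F H (\<lambda>x. \<beta> x \<cdot>\<^bsub>D\<^esub> \<alpha> x)"
proof -
  have F: "is_functor C D F" and G: "is_functor C D G" and H: "is_functor C D H"
    using a b by (simp_all add: nat_trans_def)
  interpret C: category C using F by (simp add: is_functor_def)
  interpret D: category D using F by (simp add: is_functor_def)
  show ?thesis
    unfolding nat_trans_def
  proof (intro conjI ballI allI F H)
    fix x assume "x \<in> Obj C"
    then show "\<beta> x \<cdot>\<^bsub>D\<^esub> \<alpha> x \<in> hom D (ob F x) (ob H x)"
      using nat_trans_hom[OF a] nat_trans_hom[OF b] by (blast intro: D.Comp_hom)
  next
    fix x y f assume f: "f \<in> hom C x y"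
    have x: "x \<in> Obj C" and y: "y \<in> Obj C" using C.hom_Obj[OF f] by auto
    note ax = nat_trans_hom[OF a x] and ay = nat_trans_hom[OF a y]
      and bx = nat_trans_hom[OF b x] and b_y = nat_trans_hom[OF b y]
    have "\<beta> y \<cdot>\<^bsub>D\<^esub> \<alpha> y \<cdot>\<^bsub>D\<^esub> ar F f = \<beta> y \<cdot>\<^bsub>D\<^esub> (ar G f \<cdot>\<^bsub>D\<^esub> \<alpha> x)"
      by (simp add: D.Comp_assoc[OF is_functor_ar[OF F f] ay b_y] nat_trans_natural[OF a f])
    also have "\<dots> = ar H f \<cdot>\<^bsub>D\<^esub> \<beta> x \<cdot>\<^bsub>D\<^esub> \<alpha> x"
      by (simp add: D.Comp_assoc[OF ax is_functor_ar[OF G f] b_y, symmetric] nat_trans_natural[OF b f])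
    also have "\<dots> = ar H f \<cdot>\<^bsub>D\<^esub> (\<beta> x \<cdot>\<^bsub>D\<^esub> \<alpha> x)"
      by (rule D.Comp_assoc[OF ax bx is_functor_ar[OF H f]])
    finally show "\<beta> y \<cdot>\<^bsub>D\<^esub> \<alpha> y \<cdot>\<^bsub>D\<^esub> ar F f = ar H f \<cdot>\<^bsub>D\<^esub> (\<beta> x \<cdot>\<^bsub>D\<^esub> \<alpha> x)" .
  qed
qed

text \<open>The new naturality square is the image under \<open>H\<close> of the old one, split by
  functoriality of \<open>H\<close> on each side.\<close>

lemma nat_trans_whisker_left:
  assumes a: "nat_trans C D F G \<alpha>" and H: "is_functor D E H"
  shows "nat_trans C E (H \<odot> F) (H \<odot> G) (\<lambda>x. ar H (\<alpha> x))"
proof -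
  have F: "is_functor C D F" and G: "is_functor C D G"
    using a by (simp_all add: nat_trans_def)
  interpret C: category C using F by (simp add: is_functor_def)
  show ?thesis
    unfolding nat_trans_def
  proof (intro conjI ballI allI is_functor_comp[OF F H] is_functor_comp[OF G H])
    fix x assume "x \<in> Obj C"
    then show "ar H (\<alpha> x) \<in> hom E (ob (H \<odot> F) x) (ob (H \<odot> G) x)"
      by (simp add: is_functor_ar[OF H] nat_trans_hom[OF a])
  next
    fix x y f assume f: "f \<in> hom C x y"
    have x: "x \<in> Obj C" and y: "y \<in> Obj C" using C.hom_Obj[OF f] by auto
    show "ar H (\<alpha> y) \<cdot>\<^bsub>E\<^esub> ar (H \<odot> F) f = ar (H \<odot> G) f \<cdot>\<^bsub>E\<^esub> ar H (\<alpha> x)"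
      using is_functor_Comp[OF H is_functor_ar[OF F f] nat_trans_hom[OF a y]]
        is_functor_Comp[OF H nat_trans_hom[OF a x] is_functor_ar[OF G f]]
      by (simp add: nat_trans_natural[OF a f])
  qed
qed

text \<open>The new naturality square at \<open>f\<close> is the old one at the arrow
  \<open>ar H f\<close>.\<close>

lemma nat_trans_whisker_right:
  assumes H: "is_functor C D H" and a: "nat_trans D E F G \<alpha>"
  shows "nat_trans C E (F \<odot> H) (G \<odot> H) (\<lambda>x. \<alpha> (ob H x))"
proof -
  have F: "is_functor D E F" and G: "is_functor D E G"
    using a by (simp_all add: nat_trans_def)
  show ?thesis
    unfolding nat_trans_def
    using is_functor_comp[OF H F] is_functor_comp[OF H G] nat_trans_hom[OF a] is_functor_ob[OF H]
      nat_trans_natural[OF a is_functor_ar[OF H]]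
    by simp
qed

section \<open>Uniqueness for right Kan extensions\<close>

text \<open>By \<open>eq\<close>, \<open>\<beta>\<close> and \<open>\<gamma>\<close> both factor the
  single transformation that \<open>\<beta>\<close> induces along \<open>K\<close>. The uniqueness
  clause of the universal property then identifies both with one chosen factorization, at objects of
  \<open>D\<close>.\<close>

lemma is_ran_eqI:
  assumes R: "is_ran J D E K F R \<epsilon>"
    and b: "nat_trans D E H R \<beta>" and c: "nat_trans D E H R \<gamma>"
    and eq: "\<And>j. j \<in> Obj J \<Longrightarrow> \<epsilon> j \<cdot>\<^bsub>E\<^esub> \<beta> (ob K j) = \<epsilon> j \<cdot>\<^bsub>E\<^esub> \<gamma> (ob K j)"
    and x: "x \<in> Obj D"
  shows "\<beta> x = \<gamma> x"
proof -
  have K: "is_functor J D K" and e: "nat_trans J E (R \<odot> K) F \<epsilon>"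
    using R by (simp_all add: is_ran_def)
  have H: "is_functor D E H" using b by (simp add: nat_trans_def)
  have "nat_trans J E (H \<odot> K) F (\<lambda>j. \<epsilon> j \<cdot>\<^bsub>E\<^esub> \<beta> (ob K j))"
    by (rule nat_trans_vcomp[OF nat_trans_whisker_right[OF K b] e])
  \<comment> \<open>\<open>\<delta>\<close> is the factorization supplied by the universal property;
    only its uniqueness clause is kept, since it serves as the common value of
    \<open>\<beta>\<close> and \<open>\<gamma>\<close>.\<close>
  with R H obtain \<delta> where
    "\<And>\<gamma>. nat_trans D E H R \<gamma> \<Longrightarrow> \<forall>j\<in>Obj J. \<epsilon> j \<cdot>\<^bsub>E\<^esub> \<gamma> (ob K j) = \<epsilon> j \<cdot>\<^bsub>E\<^esub> \<beta> (ob K j) \<Longrightarrow>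
      \<forall>x\<in>Obj D. \<gamma> x = \<delta> x"
    unfolding is_ran_def by (elim conjE) blast
  from this[OF b] this[OF c] x eq show ?thesis by simp
qed

section \<open>The monad laws of the codensity monad\<close>

text \<open>The definition of \<open>codensity_monad\<close> describes \<open>\<eta>\<close> and
  \<open>\<mu>\<close> by equations at the objects \<open>ob K j\<close> only. Each law is an
  equation between transformations into \<open>T\<close>, so checking it there under
  \<open>\<epsilon>\<close> yields it at every object of \<open>C\<close>.\<close>

lemma codensity_monad_is_monad:
  assumes cm: "codensity_monad J C K T \<epsilon> \<eta> \<mu>"
  shows "is_monad C T \<eta> \<mu>"
proof -
  have R: "is_ran J C C K K T \<epsilon>"
    and eta: "nat_trans C C id_fctr T \<eta>"
    and eps_eta: "\<And>j. j \<in> Obj J \<Longrightarrow> \<epsilon> j \<cdot>\<^bsub>C\<^esub> \<eta> (ob K j) = Ident C (ob K j)"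
    and mu: "nat_trans C C (T \<odot> T) T \<mu>"
    and eps_mu: "\<And>j. j \<in> Obj J \<Longrightarrow> \<epsilon> j \<cdot>\<^bsub>C\<^esub> \<mu> (ob K j) = \<epsilon> j \<cdot>\<^bsub>C\<^esub> ar T (\<epsilon> j)"
    using cm by (simp_all add: codensity_monad_def)
  have K: "is_functor J C K" and T: "is_functor C C T" and e: "nat_trans J C (T \<odot> K) K \<epsilon>"
    using R by (simp_all add: is_ran_def)
  interpret C: category C using T by (simp add: is_functor_def)
  note Tob = is_functor_ob[OF T] and Tar = is_functor_ar[OF T]
  have Kob: "ob K j \<in> Obj C" if "j \<in> Obj J" for j
    using is_functor_ob[OF K that] .
  have eps: "\<epsilon> j \<in> hom C (ob T (ob K j)) (ob K j)" if "j \<in> Obj J" for j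
    using nat_trans_hom[OF e that] by simp
  have etah: "\<eta> x \<in> hom C x (ob T x)" if "x \<in> Obj C" for x
    using nat_trans_hom[OF eta that] by simp
  have muh: "\<mu> x \<in> hom C (ob T (ob T x)) (ob T x)" if "x \<in> Obj C" for x
    using nat_trans_hom[OF mu that] by simp
  have idT: "nat_trans C C T T (\<lambda>x. Ident C (ob T x))"
    by (rule nat_trans_Ident[OF T])
  have eta_T: "nat_trans C C T (T \<odot> T) (\<lambda>x. \<eta> (ob T x))"
    using nat_trans_whisker_right[OF T eta] by simp
  have T_eta: "nat_trans C C T (T \<odot> T) (\<lambda>x. ar T (\<eta> x))"
    using nat_trans_whisker_left[OF eta T] by simp
  have mu_T: "nat_trans C C (T \<odot> T \<odot> T) (T \<odot> T) (\<lambda>x. \<mu> (ob T x))"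
    by (rule nat_trans_whisker_right[OF T mu])
  \<comment> \<open>Whiskering gives the source \<open>T \<odot> (T \<odot> T)\<close>; it is
    rebracketed to agree with that of \<open>mu_T\<close>, since \<open>is_ran_eqI\<close> requires
    a common source.\<close>
  have T_mu: "nat_trans C C (T \<odot> T \<odot> T) (T \<odot> T) (\<lambda>x. ar T (\<mu> x))"
    using nat_trans_whisker_left[OF mu T] by (simp add: comp_fctr_assoc)
  have left_unit: "\<mu> x \<cdot>\<^bsub>C\<^esub> \<eta> (ob T x) = Ident C (ob T x)" if "x \<in> Obj C" for x
  proof (rule is_ran_eqI[OF R nat_trans_vcomp[OF eta_T mu] idT _ that])
    fix j assume j: "j \<in> Obj J"
    let ?X = "ob K j"
    note X = Kob[OF j] and ej = eps[OF j]
    note TX = Tob[OF X]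
    have "\<epsilon> j \<cdot>\<^bsub>C\<^esub> (\<mu> ?X \<cdot>\<^bsub>C\<^esub> \<eta> (ob T ?X)) = \<epsilon> j \<cdot>\<^bsub>C\<^esub> ar T (\<epsilon> j) \<cdot>\<^bsub>C\<^esub> \<eta> (ob T ?X)"
      by (simp add: C.Comp_assoc[OF etah[OF TX] muh[OF X] ej, symmetric] eps_mu[OF j])
    \<comment> \<open>Naturality of \<open>\<eta>\<close> at the arrow \<open>\<epsilon> j\<close>
      moves the unit from \<open>ob T ?X\<close> to \<open>?X\<close>, where \<open>eps_eta\<close>
      can cancel it.\<close>
    also have "\<dots> = \<epsilon> j \<cdot>\<^bsub>C\<^esub> (\<eta> ?X \<cdot>\<^bsub>C\<^esub> \<epsilon> j)"
      using nat_trans_natural[OF eta ej] by (simp add: C.Comp_assoc[OF etah[OF TX] Tar[OF ej] ej])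
    also have "\<dots> = \<epsilon> j \<cdot>\<^bsub>C\<^esub> Ident C (ob T ?X)"
      by (simp add: C.Comp_assoc[OF ej etah[OF X] ej, symmetric] eps_eta[OF j]
          C.Ident_left[OF ej] C.Ident_right[OF ej])
    finally show "\<epsilon> j \<cdot>\<^bsub>C\<^esub> (\<mu> ?X \<cdot>\<^bsub>C\<^esub> \<eta> (ob T ?X)) = \<epsilon> j \<cdot>\<^bsub>C\<^esub> Ident C (ob T ?X)" .
  qed
  have right_unit: "\<mu> x \<cdot>\<^bsub>C\<^esub> ar T (\<eta> x) = Ident C (ob T x)" if "x \<in> Obj C" for x
  proof (rule is_ran_eqI[OF R nat_trans_vcomp[OF T_eta mu] idT _ that])
    fix j assume j: "j \<in> Obj J"
    let ?X = "ob K j"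
    note X = Kob[OF j] and ej = eps[OF j]
    have "\<epsilon> j \<cdot>\<^bsub>C\<^esub> (\<mu> ?X \<cdot>\<^bsub>C\<^esub> ar T (\<eta> ?X)) = \<epsilon> j \<cdot>\<^bsub>C\<^esub> ar T (\<epsilon> j) \<cdot>\<^bsub>C\<^esub> ar T (\<eta> ?X)"
      by (simp add: C.Comp_assoc[OF Tar[OF etah[OF X]] muh[OF X] ej, symmetric] eps_mu[OF j])
    also have "\<dots> = \<epsilon> j \<cdot>\<^bsub>C\<^esub> ar T (\<epsilon> j \<cdot>\<^bsub>C\<^esub> \<eta> ?X)"
      by (simp add: C.Comp_assoc[OF Tar[OF etah[OF X]] Tar[OF ej] ej]
          is_functor_Comp[OF T etah[OF X] ej])
    also have "\<dots> = \<epsilon> j \<cdot>\<^bsub>C\<^esub> Ident C (ob T ?X)"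
      by (simp add: eps_eta[OF j] is_functor_Ident[OF T X])
    finally show "\<epsilon> j \<cdot>\<^bsub>C\<^esub> (\<mu> ?X \<cdot>\<^bsub>C\<^esub> ar T (\<eta> ?X)) = \<epsilon> j \<cdot>\<^bsub>C\<^esub> Ident C (ob T ?X)" .
  qed
  have assoc: "\<mu> x \<cdot>\<^bsub>C\<^esub> \<mu> (ob T x) = \<mu> x \<cdot>\<^bsub>C\<^esub> ar T (\<mu> x)" if "x \<in> Obj C" for x
  proof (rule is_ran_eqI[OF R nat_trans_vcomp[OF mu_T mu] nat_trans_vcomp[OF T_mu mu] _ that])
    fix j assume j: "j \<in> Obj J"
    let ?X = "ob K j"
    note X = Kob[OF j] and ej = eps[OF j]
    note TX = Tob[OF X] and Tej = Tar[OF ej] and mX = muh[OF X]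
    have "\<epsilon> j \<cdot>\<^bsub>C\<^esub> (\<mu> ?X \<cdot>\<^bsub>C\<^esub> \<mu> (ob T ?X)) = \<epsilon> j \<cdot>\<^bsub>C\<^esub> ar T (\<epsilon> j) \<cdot>\<^bsub>C\<^esub> \<mu> (ob T ?X)"
      by (simp add: C.Comp_assoc[OF muh[OF TX] mX ej, symmetric] eps_mu[OF j])
    \<comment> \<open>Naturality of \<open>\<mu>\<close> at \<open>\<epsilon> j\<close> brings the
      multiplication to \<open>?X\<close>, so that \<open>eps_mu\<close> applies again and leaves a
      threefold iterate of \<open>\<epsilon>\<close>.\<close>
    also have "\<dots> = \<epsilon> j \<cdot>\<^bsub>C\<^esub> (\<mu> ?X \<cdot>\<^bsub>C\<^esub> ar T (ar T (\<epsilon> j)))"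
      using nat_trans_natural[OF mu ej] by (simp add: C.Comp_assoc[OF muh[OF TX] Tej ej])
    also have "\<dots> = \<epsilon> j \<cdot>\<^bsub>C\<^esub> (ar T (\<epsilon> j) \<cdot>\<^bsub>C\<^esub> ar T (ar T (\<epsilon> j)))"
      by (simp add: C.Comp_assoc[OF Tar[OF Tej] mX ej, symmetric]
          C.Comp_assoc[OF Tar[OF Tej] Tej ej, symmetric] eps_mu[OF j])
    \<comment> \<open>Here \<open>eps_mu\<close> is used under \<open>T\<close>, collapsing the
      inner two factors of the iterate instead of the outer two.\<close>
    also have "\<dots> = \<epsilon> j \<cdot>\<^bsub>C\<^esub> (ar T (\<epsilon> j) \<cdot>\<^bsub>C\<^esub> ar T (\<mu> ?X))"
      by (simp add: is_functor_Comp[OF T Tej ej, symmetric] is_functor_Comp[OF T mX ej, symmetric]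
          eps_mu[OF j])
    also have "\<dots> = \<epsilon> j \<cdot>\<^bsub>C\<^esub> (\<mu> ?X \<cdot>\<^bsub>C\<^esub> ar T (\<mu> ?X))"
      by (simp add: C.Comp_assoc[OF Tar[OF mX] mX ej, symmetric]
          C.Comp_assoc[OF Tar[OF mX] Tej ej, symmetric] eps_mu[OF j])
    finally show "\<epsilon> j \<cdot>\<^bsub>C\<^esub> (\<mu> ?X \<cdot>\<^bsub>C\<^esub> \<mu> (ob T ?X)) = \<epsilon> j \<cdot>\<^bsub>C\<^esub> (\<mu> ?X \<cdot>\<^bsub>C\<^esub> ar T (\<mu> ?X))" .
  qed
  show ?thesis
    unfolding is_monad_def using T eta mu left_unit right_unit assoc by blast
qed

section \<open>Compatibility of \<open>\<tau>\<close> with unit and multiplication\<close>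

theorem theorem6p4:
  fixes C :: "('x, 'm) cat"
    and B T :: "('x, 'm, 'x, 'm) fctr"
    and S :: "('o::ordinals, 'o \<times> 'o, 'x, 'm) fctr"
    and \<epsilon> :: "'o \<Rightarrow> 'm"
    and \<eta> \<mu> \<tau> :: "'x \<Rightarrow> 'm"
  assumes "complete_cat TYPE('o) C"
    and "is_functor C C B"
    and "final_sequence C B S"
    and "codensity_monad (op_cat ord_cat) C S T \<epsilon> \<eta> \<mu>"
    and "preserves_ran (op_cat ord_cat) C C C B S S T \<epsilon>"
    and "nat_trans C C (T \<odot> B) (B \<odot> T) \<tau>"
    and "\<forall>i. ar B (\<epsilon> i) \<cdot>\<^bsub>C\<^esub> \<tau> (ob S i) = \<epsilon> (ord_suc i)"
  shows "distributive_law C T \<eta> \<mu> B \<tau>"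
proof -
  let ?J = "op_cat ord_cat :: ('o, 'o \<times> 'o) cat"
  note B = assms(2) and tau = assms(6)
  have R: "is_ran ?J C C S S T \<epsilon>"
    and eta: "nat_trans C C id_fctr T \<eta>"
    and eps_eta: "\<And>i. \<epsilon> i \<cdot>\<^bsub>C\<^esub> \<eta> (ob S i) = Ident C (ob S i)"
    and mu: "nat_trans C C (T \<odot> T) T \<mu>"
    and eps_mu: "\<And>i. \<epsilon> i \<cdot>\<^bsub>C\<^esub> \<mu> (ob S i) = \<epsilon> i \<cdot>\<^bsub>C\<^esub> ar T (\<epsilon> i)"
    using assms(4) by (simp_all add: codensity_monad_def)
  have S: "is_functor ?J C S" and T: "is_functor C C T" and e: "nat_trans ?J C (T \<odot> S) S \<epsilon>"
    using R by (simp_all add: is_ran_def)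
  \<comment> \<open>Preservation by \<open>B\<close> is what makes transformations into
    \<open>B \<odot> T\<close> comparable through \<open>ar B (\<epsilon> i)\<close>; both axioms
    below are proved against this extension.\<close>
  have BR: "is_ran ?J C C S (B \<odot> S) (B \<odot> T) (\<lambda>i. ar B (\<epsilon> i))"
    using assms(5) by (simp add: preserves_ran_def)
  \<comment> \<open>Oriented towards the successor stage, so that components at
    \<open>ob B (ob S i)\<close> fall under \<open>eps_eta\<close> and \<open>eps_mu\<close> at
    index \<open>ord_suc i\<close>.\<close>
  have S_suc: "ob B (ob S i) = ob S (ord_suc i)" for i
    using assms(3) by (simp add: final_sequence_def)
  have eps_tau: "ar B (\<epsilon> i) \<cdot>\<^bsub>C\<^esub> \<tau> (ob S i) = \<epsilon> (ord_suc i)" for i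
    using assms(7) by simp
  interpret C: category C using T by (simp add: is_functor_def)
  note Tob = is_functor_ob[OF T] and Tar = is_functor_ar[OF T]
    and Bob = is_functor_ob[OF B] and Bar = is_functor_ar[OF B]
  have Sob: "ob S i \<in> Obj C" for i
    using is_functor_ob[OF S] by simp
  have eps: "\<epsilon> i \<in> hom C (ob T (ob S i)) (ob S i)" for i
    using nat_trans_hom[OF e] by simp
  have etah: "\<eta> x \<in> hom C x (ob T x)" if "x \<in> Obj C" for x
    using nat_trans_hom[OF eta that] by simp
  have muh: "\<mu> x \<in> hom C (ob T (ob T x)) (ob T x)" if "x \<in> Obj C" for x
    using nat_trans_hom[OF mu that] by simp
  have tauh: "\<tau> x \<in> hom C (ob T (ob B x)) (ob B (ob T x))" if "x \<in> Obj C" for x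
    using nat_trans_hom[OF tau that] by simp
  have B_eta: "nat_trans C C B (B \<odot> T) (\<lambda>x. ar B (\<eta> x))"
    using nat_trans_whisker_left[OF eta B] by simp
  have eta_B: "nat_trans C C B (T \<odot> B) (\<lambda>x. \<eta> (ob B x))"
    using nat_trans_whisker_right[OF B eta] by simp
  have mu_B: "nat_trans C C (T \<odot> T \<odot> B) (T \<odot> B) (\<lambda>x. \<mu> (ob B x))"
    by (rule nat_trans_whisker_right[OF B mu])
  have B_mu: "nat_trans C C (B \<odot> T \<odot> T) (B \<odot> T) (\<lambda>x. ar B (\<mu> x))"
    using nat_trans_whisker_left[OF mu B] by (simp add: comp_fctr_assoc)
  have tau_T: "nat_trans C C (T \<odot> B \<odot> T) (B \<odot> T \<odot> T) (\<lambda>x. \<tau> (ob T x))"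
    by (rule nat_trans_whisker_right[OF T tau])
  have T_tau: "nat_trans C C (T \<odot> T \<odot> B) (T \<odot> B \<odot> T) (\<lambda>x. ar T (\<tau> x))"
    using nat_trans_whisker_left[OF tau T] by (simp add: comp_fctr_assoc)
  have unit: "ar B (\<eta> x) = \<tau> x \<cdot>\<^bsub>C\<^esub> \<eta> (ob B x)" if "x \<in> Obj C" for x
  proof (rule is_ran_eqI[OF BR B_eta nat_trans_vcomp[OF eta_B tau] _ that])
    fix i :: 'o
    let ?X = "ob S i"
    note X = Sob[of i]
    have "ar B (\<epsilon> i) \<cdot>\<^bsub>C\<^esub> ar B (\<eta> ?X) = Ident C (ob B ?X)"
      by (simp add: is_functor_Comp[OF B etah[OF X] eps, symmetric] eps_eta is_functor_Ident[OF B X])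
    \<comment> \<open>The identity is re-expanded by the unit equation one stage higher, to meet the
      defining equation of \<open>\<tau>\<close>.\<close>
    also have "\<dots> = \<epsilon> (ord_suc i) \<cdot>\<^bsub>C\<^esub> \<eta> (ob B ?X)"
      by (simp add: S_suc eps_eta)
    also have "\<dots> = ar B (\<epsilon> i) \<cdot>\<^bsub>C\<^esub> (\<tau> ?X \<cdot>\<^bsub>C\<^esub> \<eta> (ob B ?X))"
      by (simp add: C.Comp_assoc[OF etah[OF Bob[OF X]] tauh[OF X] Bar[OF eps], symmetric] eps_tau)
    finally show "ar B (\<epsilon> i) \<cdot>\<^bsub>C\<^esub> ar B (\<eta> ?X) =
        ar B (\<epsilon> i) \<cdot>\<^bsub>C\<^esub> (\<tau> ?X \<cdot>\<^bsub>C\<^esub> \<eta> (ob B ?X))" .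
  qed
  have mult: "\<tau> x \<cdot>\<^bsub>C\<^esub> \<mu> (ob B x) = ar B (\<mu> x) \<cdot>\<^bsub>C\<^esub> (\<tau> (ob T x) \<cdot>\<^bsub>C\<^esub> ar T (\<tau> x))"
    if "x \<in> Obj C" for x
  proof (rule is_ran_eqI[OF BR nat_trans_vcomp[OF mu_B tau]
        nat_trans_vcomp[OF nat_trans_vcomp[OF T_tau tau_T] B_mu] _ that])
    fix i :: 'o
    let ?X = "ob S i"
    note X = Sob[of i] and ei = eps[of i]
    note TX = Tob[OF X] and BX = Bob[OF X] and Bei = Bar[OF ei]
      and BTei = Bar[OF Tar[OF ei]] and TBei = Tar[OF Bar[OF ei]]
      and tX = tauh[OF X] and mX = muh[OF X]
    note tTX = tauh[OF TX] and TtX = Tar[OF tX]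
    note tTt = C.Comp_hom[OF TtX tTX]
    have "ar B (\<epsilon> i) \<cdot>\<^bsub>C\<^esub> (\<tau> ?X \<cdot>\<^bsub>C\<^esub> \<mu> (ob B ?X)) = \<epsilon> (ord_suc i) \<cdot>\<^bsub>C\<^esub> \<mu> (ob B ?X)"
      by (simp add: C.Comp_assoc[OF muh[OF BX] tX Bei, symmetric] eps_tau)
    also have "\<dots> = \<epsilon> (ord_suc i) \<cdot>\<^bsub>C\<^esub> ar T (\<epsilon> (ord_suc i))"
      by (simp add: S_suc eps_mu)
    \<comment> \<open>Both occurrences of \<open>\<epsilon> (ord_suc i)\<close> are expanded by
      \<open>eps_tau\<close>, the inner one under \<open>T\<close>; this produces the two copies of
      \<open>\<tau>\<close> in the multiplication axiom.\<close>
    also have "\<dots> = ar B (\<epsilon> i) \<cdot>\<^bsub>C\<^esub> \<tau> ?X \<cdot>\<^bsub>C\<^esub> (ar T (ar B (\<epsilon> i)) \<cdot>\<^bsub>C\<^esub> ar T (\<tau> ?X))"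
      by (simp add: is_functor_Comp[OF T tX Bei, symmetric] eps_tau)
    also have "\<dots> = ar B (\<epsilon> i) \<cdot>\<^bsub>C\<^esub> (\<tau> ?X \<cdot>\<^bsub>C\<^esub> ar T (ar B (\<epsilon> i)) \<cdot>\<^bsub>C\<^esub> ar T (\<tau> ?X))"
      by (simp only: C.Comp_assoc[OF C.Comp_hom[OF TtX TBei] tX Bei] C.Comp_assoc[OF TtX TBei tX])
    \<comment> \<open>Naturality of \<open>\<tau>\<close> at \<open>\<epsilon> i\<close> carries the
      inner counit past the outer \<open>\<tau>\<close>, which moves to
      \<open>ob T ?X\<close>.\<close>
    also have "\<dots> = ar B (\<epsilon> i) \<cdot>\<^bsub>C\<^esub> (ar B (ar T (\<epsilon> i)) \<cdot>\<^bsub>C\<^esub> \<tau> (ob T ?X) \<cdot>\<^bsub>C\<^esub> ar T (\<tau> ?X))"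
      using nat_trans_natural[OF tau ei] by simp
    also have "\<dots> = ar B (\<epsilon> i) \<cdot>\<^bsub>C\<^esub> ar B (ar T (\<epsilon> i)) \<cdot>\<^bsub>C\<^esub> (\<tau> (ob T ?X) \<cdot>\<^bsub>C\<^esub> ar T (\<tau> ?X))"
      by (simp only: C.Comp_assoc[OF TtX tTX BTei] C.Comp_assoc[OF tTt BTei Bei])
    \<comment> \<open>With the two counits adjacent under \<open>B\<close>, \<open>eps_mu\<close> at
      the original stage \<open>i\<close> turns the inner one back into
      \<open>\<mu>\<close>.\<close>
    also have "\<dots> = ar B (\<epsilon> i) \<cdot>\<^bsub>C\<^esub> ar B (\<mu> ?X) \<cdot>\<^bsub>C\<^esub> (\<tau> (ob T ?X) \<cdot>\<^bsub>C\<^esub> ar T (\<tau> ?X))"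
      by (simp add: is_functor_Comp[OF B Tar[OF ei] ei, symmetric]
          is_functor_Comp[OF B mX ei, symmetric] eps_mu)
    also have "\<dots> = ar B (\<epsilon> i) \<cdot>\<^bsub>C\<^esub> (ar B (\<mu> ?X) \<cdot>\<^bsub>C\<^esub> (\<tau> (ob T ?X) \<cdot>\<^bsub>C\<^esub> ar T (\<tau> ?X)))"
      by (rule C.Comp_assoc[OF tTt Bar[OF mX] Bei])
    finally show "ar B (\<epsilon> i) \<cdot>\<^bsub>C\<^esub> (\<tau> ?X \<cdot>\<^bsub>C\<^esub> \<mu> (ob B ?X)) =
        ar B (\<epsilon> i) \<cdot>\<^bsub>C\<^esub> (ar B (\<mu> ?X) \<cdot>\<^bsub>C\<^esub> (\<tau> (ob T ?X) \<cdot>\<^bsub>C\<^esub> ar T (\<tau> ?X)))" .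
  qed
  show ?thesis
    unfolding distributive_law_def
    using codensity_monad_is_monad[OF assms(4)] B tau unit mult by blast
qed

end
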